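(* Let $t_0<t_1$ be real numbers, let $X$ be a Banach space, let $\alpha\ge1$, $1<p<\infty$, and $p^*=p/(p-1)$. (i) If $1<p\le2$, then $$N_{\alpha,p}\le\frac{(t_1-t_0)^\alpha}{\Gamma(\alpha)\big[(\alpha-1)p+1\big]^{1/p}\big(\alpha p^*\big)^{1/p^*}}<\frac{(t_1-t_0)^\alpha}{\Gamma(\alpha+1)}.$$ (ii) If $p>2$, then $$N_{\alpha,p}\le\frac{(t_1-t_0)^\alpha}{\Gamma(\alpha)\big[(\alpha-1)p^*+1\big]^{1/p^*}\big(\alpha p\big)^{1/p}}<\frac{(t_1-t_0)^\alpha}{\Gamma(\alpha+1)}.$$
   Context: $L^p(t_0,t_1;X)$ is the Bochner-Lebesgue space on $[t_0,t_1]$ with its usual norm. For $\alpha>0$, $J^\alpha_{t_0,t}$ is the bounded linear operator from $L^p(t_0,t_1;X)$ into itself sending $f$ to the (a.e. defined) function $t\mapsto J^\alpha_{t_0,t}f(t):=\frac{1}{\Gamma(\alpha)}\int_{t_0}^t(t-s)^{\alpha-1}f(s)\,ds$ (Bochner integral). $N_{\alpha,p}$ denotes the operator norm of $J^\alpha_{t_0,t}$ from $L^p(t_0,t_1;X)$ into itself. *)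

theory Defs
  imports "HOL-Analysis.Analysis"
begin

text \<open>
  The library's \<^const>\<open>has_bochner_integral\<close> requires a second countable (hence separable)
  target space. The following version, with strong measurability in place of Borel measurability,
  makes sense in an arbitrary Banach space.
\<close>

definition strongly_measurable :: "'b measure \<Rightarrow> ('b \<Rightarrow> 'a::real_normed_vector) \<Rightarrow> bool" where
  "strongly_measurable M f \<longleftrightarrow>
     (\<exists>s. (\<forall>i. Bochner_Integration.simple_bochner_integrable M (s i)) \<and> (AE x in M. (\<lambda>i. s i x) \<longlonglongrightarrow> f x))"

definition has_strong_integral ::
    "'b measure \<Rightarrow> ('b \<Rightarrow> 'a::real_normed_vector) \<Rightarrow> 'a \<Rightarrow> bool" where
  "has_strong_integral M f I \<longleftrightarrow>
     strongly_measurable M f \<and>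
     (\<exists>s. (\<forall>i. Bochner_Integration.simple_bochner_integrable M (s i)) \<and>
          (\<lambda>i. \<integral>\<^sup>+x. norm (f x - s i x) \<partial>M) \<longlonglongrightarrow> 0 \<and>
          (\<lambda>i. Bochner_Integration.simple_bochner_integral M (s i)) \<longlonglongrightarrow> I)"

definition strong_integral :: "'b measure \<Rightarrow> ('b \<Rightarrow> 'a::real_normed_vector) \<Rightarrow> 'a" where
  "strong_integral M f =
     (if \<exists>I. has_strong_integral M f I then THE I. has_strong_integral M f I else 0)"

lemma strongly_measurable_norm_diff:
  fixes f :: "'b \<Rightarrow> 'a::real_normed_vector"
  assumes f: "strongly_measurable M f" and s: "Bochner_Integration.simple_bochner_integrable M s"
  obtains g where "g \<in> borel_measurable M" "AE x in M. ennreal (norm (f x - s x)) = g x"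
proof -
  obtain r where r: "\<And>i. Bochner_Integration.simple_bochner_integrable M (r i)" "AE x in M. (\<lambda>i. r i x) \<longlonglongrightarrow> f x"
    using f unfolding strongly_measurable_def by blast
  define g where "g x = liminf (\<lambda>i. ennreal (norm (r i x - s x)))" for x
  have "simple_function M (\<lambda>x. ennreal (norm (r i x - s x)))" for i
    using r(1)[of i] s
    by (auto elim!: simple_bochner_integrable.cases
        intro: simple_function_compose2[where h = "\<lambda>a b. ennreal (norm (a - b))"])
  then have "g \<in> borel_measurable M"
    unfolding g_def by (intro borel_measurable_liminf borel_measurable_simple_function)
  moreover have "AE x in M. ennreal (norm (f x - s x)) = g x"
    using r(2)
  proof eventually_elim
    case (elim x)
    then have "(\<lambda>i. ennreal (norm (r i x - s x))) \<longlonglongrightarrow> ennreal (norm (f x - s x))"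
      by (intro tendsto_ennrealI tendsto_intros)
    then show ?case
      unfolding g_def by (metis lim_imp_Liminf trivial_limit_sequentially)
  qed
  ultimately show thesis
    by (rule that)
qed

lemma simple_integral_diff_bound:
  fixes f :: "'b \<Rightarrow> 'a::real_normed_vector"
  assumes f: "strongly_measurable M f"
    and s: "Bochner_Integration.simple_bochner_integrable M s" and t: "Bochner_Integration.simple_bochner_integrable M t"
  shows "ennreal (norm (Bochner_Integration.simple_bochner_integral M s -
      Bochner_Integration.simple_bochner_integral M t)) \<le>
    (\<integral>\<^sup>+x. norm (f x - s x) \<partial>M) + (\<integral>\<^sup>+x. norm (f x - t x) \<partial>M)"
proof -
  obtain g where g: "g \<in> borel_measurable M" "AE x in M. ennreal (norm (f x - s x)) = g x"
    using strongly_measurable_norm_diff[OF f s] .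
  obtain h where h: "h \<in> borel_measurable M" "AE x in M. ennreal (norm (f x - t x)) = h x"
    using strongly_measurable_norm_diff[OF f t] .
  have st: "Bochner_Integration.simple_bochner_integrable M (\<lambda>x. s x - t x)"
    using s t by (rule simple_bochner_integrable_compose2[where p = "\<lambda>a b. a - b", rotated]) simp
  have "ennreal (norm (Bochner_Integration.simple_bochner_integral M s -
      Bochner_Integration.simple_bochner_integral M t)) \<le>
      ennreal (Bochner_Integration.simple_bochner_integral M (\<lambda>x. norm (s x - t x)))"
    using simple_bochner_integral_norm_bound[OF st]
    by (simp add: simple_bochner_integral_diff[OF s t])
  also have "\<dots> = (\<integral>\<^sup>+x. norm (s x - t x) \<partial>M)"
    using simple_bochner_integrable_compose2[where p = "\<lambda>a b. norm (a - b)", OF _ s t]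
    by (intro simple_bochner_integral_eq_nn_integral) simp_all
  also have "\<dots> \<le> (\<integral>\<^sup>+x. g x + h x \<partial>M)"
  proof (rule nn_integral_mono_AE)
    show "AE x in M. ennreal (norm (s x - t x)) \<le> g x + h x"
      using g(2) h(2)
    proof eventually_elim
      case (elim x)
      have "norm (s x - t x) \<le> norm (f x - s x) + norm (f x - t x)"
        using dist_triangle3[of "s x" "t x" "f x"] by (simp add: dist_norm)
      then have "ennreal (norm (s x - t x)) \<le> ennreal (norm (f x - s x) + norm (f x - t x))"
        by (rule ennreal_leI)
      then show ?case
        by (simp add: elim[symmetric] flip: ennreal_plus)
    qed
  qed
  also have "\<dots> = (\<integral>\<^sup>+x. g x \<partial>M) + (\<integral>\<^sup>+x. h x \<partial>M)"
    using g(1) h(1) by (rule nn_integral_add)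
  also have "\<dots> = (\<integral>\<^sup>+x. norm (f x - s x) \<partial>M) + (\<integral>\<^sup>+x. norm (f x - t x) \<partial>M)"
    using g(2) h(2) by (auto intro!: arg_cong2[where f = "(+)"] nn_integral_cong_AE)
  finally show ?thesis .
qed

lemma has_strong_integral_unique:
  fixes f :: "'b \<Rightarrow> 'a::real_normed_vector"
  assumes "has_strong_integral M f I" "has_strong_integral M f J"
  shows "I = J"
proof -
  have f: "strongly_measurable M f"
    using assms(1) by (simp add: has_strong_integral_def)
  obtain s where s: "\<And>i. Bochner_Integration.simple_bochner_integrable M (s i)"
      "(\<lambda>i. \<integral>\<^sup>+x. norm (f x - s i x) \<partial>M) \<longlonglongrightarrow> 0"
      "(\<lambda>i. Bochner_Integration.simple_bochner_integral M (s i)) \<longlonglongrightarrow> I"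
    using assms(1) unfolding has_strong_integral_def by blast
  obtain t where t: "\<And>i. Bochner_Integration.simple_bochner_integrable M (t i)"
      "(\<lambda>i. \<integral>\<^sup>+x. norm (f x - t i x) \<partial>M) \<longlonglongrightarrow> 0"
      "(\<lambda>i. Bochner_Integration.simple_bochner_integral M (t i)) \<longlonglongrightarrow> J"
    using assms(2) unfolding has_strong_integral_def by blast
  have "(\<lambda>i. ennreal (norm (Bochner_Integration.simple_bochner_integral M (s i) - Bochner_Integration.simple_bochner_integral M (t i))))
      \<longlonglongrightarrow> ennreal (norm (I - J))"
    using s(3) t(3) by (intro tendsto_ennrealI tendsto_intros)
  moreover have "(\<lambda>i. (\<integral>\<^sup>+x. norm (f x - s i x) \<partial>M) + (\<integral>\<^sup>+x. norm (f x - t i x) \<partial>M))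
      \<longlonglongrightarrow> 0 + 0"
    using s(2) t(2) by (rule tendsto_add)
  ultimately have "ennreal (norm (I - J)) \<le> 0 + 0"
    by (rule LIMSEQ_le) (use simple_integral_diff_bound[OF f s(1) t(1)] in blast)
  then show ?thesis
    by (simp add: ennreal_eq_0_iff)
qed

lemma strong_integral_eqI:
  "has_strong_integral M f I \<Longrightarrow> strong_integral M f = I"
  unfolding strong_integral_def using has_strong_integral_unique by (metis the_equality)

lemma strong_integral_eq_lebesgue_integral:
  fixes f :: "'b \<Rightarrow> 'a::{banach, second_countable_topology}"
  assumes "integrable M f"
  shows "strong_integral M f = integral\<^sup>L M f"
proof (rule strong_integral_eqI)
  have "has_bochner_integral M f (integral\<^sup>L M f)"
    using assms by (rule has_bochner_integral_integrable)
  then obtain s where s: "\<And>i. Bochner_Integration.simple_bochner_integrable M (s i)"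
      "(\<lambda>i. \<integral>\<^sup>+x. norm (f x - s i x) \<partial>M) \<longlonglongrightarrow> 0"
      "(\<lambda>i. Bochner_Integration.simple_bochner_integral M (s i)) \<longlonglongrightarrow> integral\<^sup>L M f"
    by (auto elim!: has_bochner_integral.cases)
  obtain r where r: "\<And>i. simple_function M (r i)"
      "\<And>x. x \<in> space M \<Longrightarrow> (\<lambda>i. r i x) \<longlonglongrightarrow> f x"
      "\<And>i x. x \<in> space M \<Longrightarrow> dist (r i x) 0 \<le> 2 * dist (f x) 0"
    using borel_measurable_implies_sequence_metric[OF borel_measurable_integrable[OF assms], of 0]
    by blast
  have "Bochner_Integration.simple_bochner_integrable M (r i)" for i
  proof (rule simple_bochner_integrableI_bounded[OF r(1)])
    have "(\<integral>\<^sup>+x. norm (r i x) \<partial>M) \<le> (\<integral>\<^sup>+x. norm (2 *\<^sub>R f x) \<partial>M)"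
      using r(3) by (intro nn_integral_mono ennreal_leI) (auto simp: dist_norm)
    also have "\<dots> < \<infinity>"
      using integrable_scaleR_right[OF assms, of 2] by (simp only: integrable_iff_bounded)
    finally show "(\<integral>\<^sup>+x. norm (r i x) \<partial>M) < \<infinity>" .
  qed
  then have "strongly_measurable M f"
    unfolding strongly_measurable_def using r(2) by (intro exI[of _ r]) auto
  then show "has_strong_integral M f (integral\<^sup>L M f)"
    unfolding has_strong_integral_def using s by blast
qed

text \<open>
  Elements of the Bochner-Lebesgue space are represented by functions on the real line; only their
  values almost everywhere on the interval matter.
\<close>

definition Lp_space :: "real \<Rightarrow> real \<Rightarrow> real \<Rightarrow> (real \<Rightarrow> 'a::real_normed_vector) set" where
  "Lp_space p t0 t1 =
     {f. strongly_measurable (lebesgue_on {t0..t1}) f \<and>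
         integrable (lebesgue_on {t0..t1}) (\<lambda>t. norm (f t) powr p)}"

definition Lp_norm :: "real \<Rightarrow> real \<Rightarrow> real \<Rightarrow> (real \<Rightarrow> 'a::real_normed_vector) \<Rightarrow> real" where
  "Lp_norm p t0 t1 f = (LINT t | lebesgue_on {t0..t1}. norm (f t) powr p) powr (1 / p)"

text \<open>
  The operator norm is extended-valued: it is \<open>\<infinity>\<close> unless \<open>T\<close> maps the space boundedly into itself.
\<close>

definition Lp_opnorm ::
    "real \<Rightarrow> real \<Rightarrow> real \<Rightarrow> ((real \<Rightarrow> 'a::real_normed_vector) \<Rightarrow> real \<Rightarrow> 'a) \<Rightarrow> ennreal" where
  "Lp_opnorm p t0 t1 T =
     Inf {ennreal C | C. 0 \<le> C \<and>
       (\<forall>f\<in>Lp_space p t0 t1.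
          T f \<in> Lp_space p t0 t1 \<and> Lp_norm p t0 t1 (T f) \<le> C * Lp_norm p t0 t1 f)}"

definition RL_integral ::
    "real \<Rightarrow> real \<Rightarrow> (real \<Rightarrow> 'a::real_normed_vector) \<Rightarrow> real \<Rightarrow> 'a" where
  "RL_integral \<alpha> t0 f t =
     (1 / Gamma \<alpha>) *\<^sub>R
       strong_integral (lebesgue_on {t0..t}) (\<lambda>s. (t - s) powr (\<alpha> - 1) *\<^sub>R f s)"

end

theory Submission
  imports Defs
begin

text \<open>
  Up to the factor \<open>1 / \<Gamma>(\<alpha>)\<close>, the Riemann-Liouville operator has the kernel
  \<open>k(t, s) = (t - s) powr (\<alpha> - 1)\<close> on the triangle \<open>t0 \<le> s \<le> t \<le> t1\<close>, which is nonnegative.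
  Hence \<open>\<Gamma>(\<alpha>) \<parallel>J f(t)\<parallel> \<le> \<integral> k(t, s) \<parallel>f(s)\<parallel> ds\<close>, and everything reduces to the norm of a positive
  integral operator on scalar functions. Such a norm is at most either of the two mixed norms of
  the kernel, and with \<open>q\<close> the exponent conjugate to \<open>p\<close> both can be computed:

  \<^item> the \<open>L\<^sup>p\<close> norm in \<open>t\<close> of the \<open>L\<^sup>q\<close> norm of the row \<open>k(t, \<cdot>)\<close>, which comes from
    Hoelder's inequality in \<open>s\<close>;
  \<^item> the \<open>L\<^sup>q\<close> norm in \<open>s\<close> of the \<open>L\<^sup>p\<close> norm of the column \<open>k(\<cdot>, s)\<close>, which is
    usually obtained from Minkowski's integral inequality, or by duality.

  Both are instances of one argument, \<open>factored_kernel_Lp_bound\<close>: write \<open>k = a b\<close>, apply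
  Hoelder's inequality in \<open>s\<close> to the pair \<open>a\<close>, \<open>b \<parallel>f\<parallel>\<close>, and exchange the order of integration. The
  choice \<open>a = k\<close>, \<open>b = 1\<close> gives the row bound. Taking for \<open>a(t, s) = w(s)\<close> a multiple of the
  norm of the column through \<open>s\<close>, and \<open>b = k / w\<close>, gives the column bound. The
  theorem quotes the column bound for \<open>p \<le> 2\<close> and the row bound for \<open>p > 2\<close>.

  That the constants improve on \<open>(t1 - t0) powr \<alpha> / \<Gamma>(\<alpha> + 1)\<close> is elementary: since
  \<open>\<Gamma>(\<alpha> + 1) = \<alpha> \<Gamma>(\<alpha>)\<close> and \<open>\<alpha> = \<alpha> powr (1 / p) * \<alpha> powr (1 / q)\<close>, it is enough to see that
  \<open>(\<alpha> - 1) p + 1 \<ge> \<alpha>\<close> and \<open>\<alpha> q > \<alpha>\<close>; for the row bound \<open>p\<close> and \<open>q\<close> change places.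

  The operator norm is finite only if \<open>J f\<close> is again a member of the space. For \<open>f\<close> in \<open>L\<^sup>p\<close>, hence
  in \<open>L\<^sup>1\<close>, dominated convergence shows that \<open>J f\<close> is continuous on \<open>[t0, t1]\<close>; a continuous
  function on a compact interval is a limit of step functions, so it is strongly measurable even
  if the Banach space is not separable. The Bochner integral is treated in that generality: an
  integral exists as soon as the norm has finite integral, and
  \<open>\<parallel>\<integral> f - \<integral> g\<parallel> \<le> \<integral> \<parallel>f - g\<parallel>\<close>.
\<close>

section \<open>Hoelder's inequality and factored kernels\<close>

text \<open>
  Young's inequality for the functions normalised by \<open>W powr (1 / q)\<close> and \<open>v powr (1 / p)\<close>, where
  \<open>v\<close> is the integral of \<open>b powr p\<close>. A bound for \<open>x powr p\<close> with the integral of \<open>b powr p\<close> on the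
  right, which may be infinite, is what integration over a further variable calls for.
\<close>

lemma Holder_nn_integral:
  fixes a b :: "'b \<Rightarrow> real" and p q x W :: real
  assumes pq: "1 < p" "1 < q" "1 / p + 1 / q = 1"
    and [measurable]: "a \<in> borel_measurable M" "b \<in> borel_measurable M"
    and nonneg: "\<And>s. 0 \<le> a s" "\<And>s. 0 \<le> b s" "0 \<le> x"
    and W: "0 < W" "(\<integral>\<^sup>+s. a s powr q \<partial>M) \<le> ennreal W"
    and x: "ennreal x \<le> (\<integral>\<^sup>+s. a s * b s \<partial>M)"
  shows "ennreal (x powr p) \<le> ennreal (W powr (p / q)) * (\<integral>\<^sup>+s. b s powr p \<partial>M)"
proof (cases "(\<integral>\<^sup>+s. b s powr p \<partial>M)")
  case top
  then show ?thesis using W by (simp add: ennreal_mult_top)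
next
  case (real v)
  show ?thesis
  proof (cases "v = 0")
    case True
    have "AE s in M. b s = 0"
      using real True pq nonneg by (simp add: nn_integral_0_iff_AE)
    then have "(\<integral>\<^sup>+s. a s * b s \<partial>M) = (\<integral>\<^sup>+s. 0 \<partial>M)"
      by (intro nn_integral_cong_AE) auto
    then have "x = 0" using x nonneg by (simp add: ennreal_eq_0_iff)
    then show ?thesis by simp
  next
    case False
    with real have v: "v > 0" by simp
    define c where "c = W powr (1 / q) * v powr (1 / p)"
    have c: "c > 0" using v W by (simp add: c_def)
    have young: "a s * b s \<le> (c / (q * W)) * a s powr q + (c / (p * v)) * b s powr p" for s
    proof -
      have "(a s / W powr (1 / q)) * (b s / v powr (1 / p))
          \<le> (a s / W powr (1 / q)) powr q / q + (b s / v powr (1 / p)) powr p / p"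
        using pq nonneg by (intro Youngs_inequality) auto
      also have "\<dots> = a s powr q / (q * W) + b s powr p / (p * v)"
        using pq nonneg v W by (simp add: powr_divide powr_powr mult.commute)
      finally have "a s * b s / c \<le> a s powr q / (q * W) + b s powr p / (p * v)"
        by (simp add: c_def)
      then show ?thesis
        using c by (simp add: divide_le_eq field_simps)
    qed
    have "(\<integral>\<^sup>+s. a s * b s \<partial>M)
        \<le> (\<integral>\<^sup>+s. ennreal (c / (q * W)) * ennreal (a s powr q)
                + ennreal (c / (p * v)) * ennreal (b s powr p) \<partial>M)"
      using young c pq W v
      by (intro nn_integral_mono) (simp flip: ennreal_mult ennreal_plus)
    also have "\<dots> = ennreal (c / (q * W)) * (\<integral>\<^sup>+s. a s powr q \<partial>M)
        + ennreal (c / (p * v)) * (\<integral>\<^sup>+s. b s powr p \<partial>M)"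
      by (simp add: nn_integral_add nn_integral_cmult)
    also have "\<dots> \<le> ennreal (c / (q * W)) * ennreal W + ennreal (c / (p * v)) * ennreal v"
      using W real by (intro add_mono mult_left_mono) auto
    also have "\<dots> = ennreal (c / (q * W) * W + c / (p * v) * v)"
      using c pq W v by (simp flip: ennreal_mult ennreal_plus)
    also have "c / (q * W) * W + c / (p * v) * v = c * (1 / p + 1 / q)"
      using v W by (simp add: field_simps)
    finally have "ennreal x \<le> ennreal c" using x pq by (simp add: order_trans)
    then have "x \<le> c" using c by simp
    then have "x powr p \<le> c powr p" using nonneg pq by (intro powr_mono2) auto
    also have "\<dots> = W powr (p / q) * v"
      using v W pq by (simp add: c_def powr_mult powr_powr)
    finally show ?thesis using real v W by (simp flip: ennreal_mult)
  qed
qed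

text \<open>
  A kernel \<open>a b\<close> is bounded on \<open>L\<^sup>p\<close> if the \<open>q\<close>-th powers of the rows of \<open>a\<close> integrate to \<open>A\<close> and
  the \<open>p\<close>-th powers of the columns of \<open>b\<close> are integrable against \<open>A powr (p / q)\<close>. Hoelder's
  inequality for fixed \<open>t\<close> leaves \<open>u powr p\<close> under a double integral, and after the exchange of
  the order of integration the inner integral is the one bounded by \<open>D\<close>.
\<close>

lemma factored_kernel_Lp_bound:
  fixes a b :: "'b \<Rightarrow> 'b \<Rightarrow> real" and \<phi> u A :: "'b \<Rightarrow> real" and p q :: real
  assumes M: "sigma_finite_measure M"
    and pq: "1 < p" "1 < q" "1 / p + 1 / q = 1"
    and [measurable]: "case_prod a \<in> borel_measurable (M \<Otimes>\<^sub>M M)"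
      "case_prod b \<in> borel_measurable (M \<Otimes>\<^sub>M M)"
      "A \<in> borel_measurable M" "u \<in> borel_measurable M"
    and nonneg: "\<And>t s. 0 \<le> a t s" "\<And>t s. 0 \<le> b t s" "\<And>s. 0 \<le> u s" "\<And>t. 0 \<le> \<phi> t"
    and \<phi>: "AE t in M. ennreal (\<phi> t) \<le> (\<integral>\<^sup>+s. a t s * (b t s * u s) \<partial>M)"
    and A: "AE t in M. 0 < A t \<and> (\<integral>\<^sup>+s. a t s powr q \<partial>M) \<le> ennreal (A t)"
    and D: "AE s in M. (\<integral>\<^sup>+t. A t powr (p / q) * b t s powr p \<partial>M) \<le> ennreal D"
  shows "(\<integral>\<^sup>+t. \<phi> t powr p \<partial>M) \<le> ennreal D * (\<integral>\<^sup>+s. u s powr p \<partial>M)"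
proof -
  interpret M: sigma_finite_measure M by fact
  interpret pair_sigma_finite M M ..
  have "(\<integral>\<^sup>+t. \<phi> t powr p \<partial>M)
      \<le> (\<integral>\<^sup>+t. ennreal (A t powr (p / q)) * (\<integral>\<^sup>+s. (b t s * u s) powr p \<partial>M) \<partial>M)"
  proof (rule nn_integral_mono_AE)
    show "AE t in M. ennreal (\<phi> t powr p)
        \<le> ennreal (A t powr (p / q)) * (\<integral>\<^sup>+s. (b t s * u s) powr p \<partial>M)"
      using \<phi> A AE_space
    proof eventually_elim
      case (elim t)
      then have [measurable]: "t \<in> space M" by simp
      show ?case
        by (rule Holder_nn_integral[OF pq]) (use elim nonneg in auto)
    qed
  qed
  also have "\<dots> = (\<integral>\<^sup>+t. (\<integral>\<^sup>+s. ennreal (A t powr (p / q) * b t s powr p) * ennreal (u s powr p) \<partial>M) \<partial>M)"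
  proof (rule nn_integral_cong)
    fix t assume [measurable]: "t \<in> space M"
    have "ennreal (A t powr (p / q)) * (\<integral>\<^sup>+s. (b t s * u s) powr p \<partial>M)
       = (\<integral>\<^sup>+s. ennreal (A t powr (p / q)) * ennreal ((b t s * u s) powr p) \<partial>M)"
      by (rule nn_integral_cmult[symmetric]) measurable
    then show "ennreal (A t powr (p / q)) * (\<integral>\<^sup>+s. (b t s * u s) powr p \<partial>M)
       = (\<integral>\<^sup>+s. ennreal (A t powr (p / q) * b t s powr p) * ennreal (u s powr p) \<partial>M)"
      using nonneg by (simp add: powr_mult mult.assoc flip: ennreal_mult)
  qed
  also have "\<dots> = (\<integral>\<^sup>+s. (\<integral>\<^sup>+t. ennreal (A t powr (p / q) * b t s powr p) * ennreal (u s powr p) \<partial>M) \<partial>M)"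
    by (rule Fubini') measurable
  also have "\<dots> = (\<integral>\<^sup>+s. (\<integral>\<^sup>+t. A t powr (p / q) * b t s powr p \<partial>M) * ennreal (u s powr p) \<partial>M)"
    by (intro nn_integral_cong nn_integral_multc) measurable
  also have "\<dots> \<le> (\<integral>\<^sup>+s. ennreal D * ennreal (u s powr p) \<partial>M)"
    by (rule nn_integral_mono_AE, use D in eventually_elim) (rule mult_right_mono, auto)
  also have "\<dots> = ennreal D * (\<integral>\<^sup>+s. u s powr p \<partial>M)"
    by (rule nn_integral_cmult) measurable
  finally show ?thesis .
qed

section \<open>Integration in an arbitrary Banach space\<close>

lemma strongly_measurableE:
  fixes f :: "'b \<Rightarrow> 'a::real_normed_vector"
  assumes "strongly_measurable M f"
  obtains r where "\<And>i. Bochner_Integration.simple_bochner_integrable M (r i)"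
    "AE x in M. (\<lambda>i. r i x) \<longlonglongrightarrow> f x"
  using assms unfolding strongly_measurable_def by blast

lemma simple_bochner_integrable_zero:
  "Bochner_Integration.simple_bochner_integrable M (\<lambda>x. 0::'a::real_normed_vector)"
  by (rule simple_bochner_integrableI_bounded) auto

lemma simple_bochner_integral_zero:
  "Bochner_Integration.simple_bochner_integral M (\<lambda>x. 0::'a::real_normed_vector) = 0"
  by (auto simp: simple_bochner_integral_def image_constant_conv)

text \<open>
  The norm of a strongly measurable function need not be Borel measurable in a measure space that
  is not complete; additivity and dominated convergence of integrals are applied to this version.
\<close>

lemma strongly_measurable_norm_version:
  fixes f :: "'b \<Rightarrow> 'a::real_normed_vector"
  assumes f: "strongly_measurable M f" and s: "Bochner_Integration.simple_bochner_integrable M s"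
  obtains h :: "'b \<Rightarrow> real" where "h \<in> borel_measurable M" "\<And>x. 0 \<le> h x" "AE x in M. norm (f x - s x) = h x"
proof -
  obtain g where g: "g \<in> borel_measurable M" "AE x in M. ennreal (norm (f x - s x)) = g x"
    using strongly_measurable_norm_diff[OF assms] .
  show thesis
  proof (rule that)
    show "(\<lambda>x. enn2real (g x)) \<in> borel_measurable M" using g(1) by measurable
    show "AE x in M. norm (f x - s x) = enn2real (g x)"
      using g(2) by eventually_elim (metis enn2real_ennreal norm_ge_zero)
  qed simp
qed

lemma strongly_measurable_diff:
  fixes f g :: "'b \<Rightarrow> 'a::real_normed_vector"
  assumes "strongly_measurable M f" "strongly_measurable M g"
  shows "strongly_measurable M (\<lambda>x. f x - g x)"
proof -
  obtain r where r: "\<And>i. Bochner_Integration.simple_bochner_integrable M (r i)"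
      "AE x in M. (\<lambda>i. r i x) \<longlonglongrightarrow> f x"
    using strongly_measurableE[OF assms(1)] by blast
  obtain s where s: "\<And>i. Bochner_Integration.simple_bochner_integrable M (s i)"
      "AE x in M. (\<lambda>i. s i x) \<longlonglongrightarrow> g x"
    using strongly_measurableE[OF assms(2)] by blast
  have "Bochner_Integration.simple_bochner_integrable M (\<lambda>x. r i x - s i x)" for i
    by (rule simple_bochner_integrable_compose2[where p = "(-)"]) (use r s in auto)
  moreover have "AE x in M. (\<lambda>i. r i x - s i x) \<longlonglongrightarrow> f x - g x"
    using r(2) s(2) by eventually_elim (rule tendsto_diff)
  ultimately show ?thesis
    unfolding strongly_measurable_def by (intro exI[of _ "\<lambda>i x. r i x - s i x"]) auto
qed

lemma strongly_measurable_scaleR: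
  fixes f :: "'b \<Rightarrow> 'a::real_normed_vector" and h :: "'b \<Rightarrow> real"
  assumes M: "finite_measure M" and h: "h \<in> borel_measurable M" and f: "strongly_measurable M f"
  shows "strongly_measurable M (\<lambda>x. h x *\<^sub>R f x)"
proof -
  interpret finite_measure M by fact
  obtain u where u: "\<And>i. simple_function M (u i)" "\<And>x. x \<in> space M \<Longrightarrow> (\<lambda>i. u i x) \<longlonglongrightarrow> h x"
    using borel_measurable_implies_sequence_metric[OF h, of 0] by blast
  obtain r where r: "\<And>i. Bochner_Integration.simple_bochner_integrable M (r i)"
      "AE x in M. (\<lambda>i. r i x) \<longlonglongrightarrow> f x"
    using strongly_measurableE[OF f] by blast
  have "Bochner_Integration.simple_bochner_integrable M (\<lambda>x. u i x *\<^sub>R r i x)" for i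
  proof (rule simple_bochner_integrable_compose2[where p = "(*\<^sub>R)"])
    show "Bochner_Integration.simple_bochner_integrable M (u i)"
      using u(1) by (rule simple_bochner_integrable.intros) auto
  qed (use r in auto)
  moreover have "AE x in M. (\<lambda>i. u i x *\<^sub>R r i x) \<longlonglongrightarrow> h x *\<^sub>R f x"
    using r(2) AE_space by eventually_elim (intro tendsto_scaleR u)
  ultimately show ?thesis
    unfolding strongly_measurable_def by (intro exI[of _ "\<lambda>i x. u i x *\<^sub>R r i x"]) auto
qed

lemma strongly_measurable_restrict_space:
  fixes f :: "'b \<Rightarrow> 'a::real_normed_vector"
  assumes \<Omega>: "\<Omega> \<in> sets M" and f: "strongly_measurable M f"
  shows "strongly_measurable (restrict_space M \<Omega>) f"
proof -
  have \<Omega>': "\<Omega> \<inter> space M \<in> sets M" using \<Omega> by auto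
  obtain r where r: "\<And>i. Bochner_Integration.simple_bochner_integrable M (r i)"
      "AE x in M. (\<lambda>i. r i x) \<longlonglongrightarrow> f x"
    using strongly_measurableE[OF f] by blast
  have "Bochner_Integration.simple_bochner_integrable (restrict_space M \<Omega>) (r i)" for i
  proof -
    have "simple_function M (\<lambda>x. indicator \<Omega> x *\<^sub>R r i x)"
      using r(1)[of i] \<Omega>
      by (auto elim!: simple_bochner_integrable.cases intro!: simple_function_compose2[where h = "(*\<^sub>R)"])
    moreover have "emeasure M {y \<in> space M. indicator \<Omega> y *\<^sub>R r i y \<noteq> 0}
        \<le> emeasure M {y \<in> space M. r i y \<noteq> 0}"
      using r(1)[of i]
      by (intro emeasure_mono) (auto elim!: simple_bochner_integrable.cases
          dest!: simple_functionD(2)[where X = "- {0}"] simp: vimage_def Int_def conj_commute)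
    ultimately show ?thesis
      unfolding simple_bochner_integrable_restrict_space[OF \<Omega>'] using r(1)[of i]
      by (auto intro!: simple_bochner_integrable.intros elim!: simple_bochner_integrable.cases
          simp: top_unique)
  qed
  moreover have "AE x in restrict_space M \<Omega>. (\<lambda>i. r i x) \<longlonglongrightarrow> f x"
    unfolding AE_restrict_space_iff[OF \<Omega>'] using r(2) by auto
  ultimately show ?thesis unfolding strongly_measurable_def by blast
qed

lemma has_strong_integral_zero: "has_strong_integral M (\<lambda>x. 0::'a::real_normed_vector) 0"
proof -
  show ?thesis
    unfolding has_strong_integral_def strongly_measurable_def
    by (auto simp: simple_bochner_integral_zero simple_bochner_integrable_zero intro!: exI[of _ "\<lambda>i x. 0"])
qed

text \<open>
  Approximating both functions by simple ones leaves the difference of two simple integrals, which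
  is at most the integral of \<open>norm (f - g)\<close> plus the two approximation errors. With \<open>g = 0\<close> this is
  the norm estimate for the integral.
\<close>

lemma has_strong_integral_norm_diff_le:
  fixes f g :: "'b \<Rightarrow> 'a::real_normed_vector"
  assumes f: "has_strong_integral M f I" and g: "has_strong_integral M g J"
  shows "ennreal (norm (I - J)) \<le> (\<integral>\<^sup>+x. norm (f x - g x) \<partial>M)"
proof -
  have fm: "strongly_measurable M f" and gm: "strongly_measurable M g"
    using f g by (auto simp: has_strong_integral_def)
  note dm = strongly_measurable_diff[OF fm gm]
  obtain s where s: "\<And>i. Bochner_Integration.simple_bochner_integrable M (s i)"
      "(\<lambda>i. \<integral>\<^sup>+x. norm (f x - s i x) \<partial>M) \<longlonglongrightarrow> 0"
      "(\<lambda>i. Bochner_Integration.simple_bochner_integral M (s i)) \<longlonglongrightarrow> I"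
    using f unfolding has_strong_integral_def by blast
  obtain t where t: "\<And>i. Bochner_Integration.simple_bochner_integrable M (t i)"
      "(\<lambda>i. \<integral>\<^sup>+x. norm (g x - t i x) \<partial>M) \<longlonglongrightarrow> 0"
      "(\<lambda>i. Bochner_Integration.simple_bochner_integral M (t i)) \<longlonglongrightarrow> J"
    using g unfolding has_strong_integral_def by blast
  let ?S = "Bochner_Integration.simple_bochner_integral M"
  have bound: "ennreal (norm (?S (s i) - ?S (t i))) \<le> (\<integral>\<^sup>+x. norm (f x - s i x) \<partial>M)
      + (\<integral>\<^sup>+x. norm (g x - t i x) \<partial>M) + (\<integral>\<^sup>+x. norm (f x - g x) \<partial>M)" for i
  proof -
    have st: "Bochner_Integration.simple_bochner_integrable M (\<lambda>x. s i x - t i x)"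
      by (rule simple_bochner_integrable_compose2[where p = "(-)"]) (use s t in auto)
    obtain h where h: "h \<in> borel_measurable M" "\<And>x. 0 \<le> h x" "AE x in M. norm (f x - s i x) = h x"
      using strongly_measurable_norm_version[OF fm s(1)] by blast
    obtain k where k: "k \<in> borel_measurable M" "\<And>x. 0 \<le> k x" "AE x in M. norm (g x - t i x) = k x"
      using strongly_measurable_norm_version[OF gm t(1)] by blast
    have "ennreal (norm (?S (s i) - ?S (t i))) = ennreal (norm (?S (\<lambda>x. s i x - t i x) - ?S (\<lambda>x. 0)))"
      using simple_bochner_integral_diff[OF s(1) t(1)] by (simp add: simple_bochner_integral_zero)
    also have "\<dots> \<le> (\<integral>\<^sup>+x. norm (f x - g x - (s i x - t i x)) \<partial>M) + (\<integral>\<^sup>+x. norm (f x - g x - 0) \<partial>M)"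
      by (rule simple_integral_diff_bound[OF dm st simple_bochner_integrable_zero])
    also have "(\<integral>\<^sup>+x. norm (f x - g x - (s i x - t i x)) \<partial>M) \<le> (\<integral>\<^sup>+x. ennreal (h x) + ennreal (k x) \<partial>M)"
    proof (rule nn_integral_mono_AE)
      show "AE x in M. ennreal (norm (f x - g x - (s i x - t i x))) \<le> ennreal (h x) + ennreal (k x)"
        using h(3) k(3)
      proof eventually_elim
        case (elim x)
        have "norm (f x - g x - (s i x - t i x)) = norm ((f x - s i x) - (g x - t i x))"
          by (simp add: algebra_simps)
        also have "\<dots> \<le> h x + k x" using elim by (metis norm_triangle_ineq4)
        finally show ?case using h(2) k(2) by (simp flip: ennreal_plus)
      qed
    qed
    also have "\<dots> = (\<integral>\<^sup>+x. h x \<partial>M) + (\<integral>\<^sup>+x. k x \<partial>M)"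
      using h(1) k(1) by (intro nn_integral_add) auto
    also have "(\<integral>\<^sup>+x. h x \<partial>M) = (\<integral>\<^sup>+x. norm (f x - s i x) \<partial>M)"
      using h(3) by (intro nn_integral_cong_AE) auto
    also have "(\<integral>\<^sup>+x. k x \<partial>M) = (\<integral>\<^sup>+x. norm (g x - t i x) \<partial>M)"
      using k(3) by (intro nn_integral_cong_AE) auto
    finally show ?thesis by (simp add: add_right_mono)
  qed
  have "(\<lambda>i. ennreal (norm (?S (s i) - ?S (t i)))) \<longlonglongrightarrow> ennreal (norm (I - J))"
    using s(3) t(3) by (intro tendsto_ennrealI tendsto_intros)
  moreover have "(\<lambda>i. (\<integral>\<^sup>+x. norm (f x - s i x) \<partial>M) + (\<integral>\<^sup>+x. norm (g x - t i x) \<partial>M)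
      + (\<integral>\<^sup>+x. norm (f x - g x) \<partial>M)) \<longlonglongrightarrow> 0 + 0 + (\<integral>\<^sup>+x. norm (f x - g x) \<partial>M)"
    using s(2) t(2) by (intro tendsto_add tendsto_const)
  ultimately have "ennreal (norm (I - J)) \<le> 0 + 0 + (\<integral>\<^sup>+x. norm (f x - g x) \<partial>M)"
    by (rule LIMSEQ_le) (use bound in blast)
  then show ?thesis by simp
qed

text \<open>
  The simple functions \<open>r i\<close> that converge to \<open>f\<close> almost everywhere are cut off where they exceed
  \<open>2 m i\<close>, with \<open>m i\<close> simple and convergent to the norm of \<open>f\<close>. The cut-off functions are simple and
  dominated by a multiple of that norm, so they converge to \<open>f\<close> in \<open>L\<^sup>1\<close>, and by completeness of the
  space their integrals converge.
\<close>

lemma has_strong_integral_exists: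
  fixes f :: "'b \<Rightarrow> 'a::banach"
  assumes f: "strongly_measurable M f" and fin: "(\<integral>\<^sup>+x. norm (f x) \<partial>M) < \<infinity>"
  obtains I where "has_strong_integral M f I"
proof -
  obtain r where r: "\<And>i. Bochner_Integration.simple_bochner_integrable M (r i)"
      "AE x in M. (\<lambda>i. r i x) \<longlonglongrightarrow> f x"
    using strongly_measurableE[OF f] by blast
  obtain h where h: "h \<in> borel_measurable M" "\<And>x. 0 \<le> h x" "AE x in M. norm (f x) = h x"
    using strongly_measurable_norm_version[OF f simple_bochner_integrable_zero] by auto
  have hfin: "(\<integral>\<^sup>+x. h x \<partial>M) < \<infinity>"
    
  proof -
    have "(\<integral>\<^sup>+x. h x \<partial>M) = (\<integral>\<^sup>+x. norm (f x) \<partial>M)"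
      using h(3) by (intro nn_integral_cong_AE) auto
    with fin show ?thesis by simp
  qed
  obtain m where m: "\<And>i. simple_function M (m i)" "\<And>x. x \<in> space M \<Longrightarrow> (\<lambda>i. m i x) \<longlonglongrightarrow> h x"
      "\<And>i x. x \<in> space M \<Longrightarrow> \<bar>m i x\<bar> \<le> 2 * h x"
    using borel_measurable_implies_sequence_metric[OF h(1), of 0] h(2) by (auto simp: dist_real_def) metis
  define s where "s i x = (if norm (r i x) \<le> 2 * m i x then r i x else 0)" for i x
  have s_simple: "Bochner_Integration.simple_bochner_integrable M (s i)" for i
    unfolding s_def
  proof (rule simple_bochner_integrableI_bounded)
    show "simple_function M (\<lambda>x. if norm (r i x) \<le> 2 * m i x then r i x else 0)"
      using r(1)[of i] m(1)[of i]
      by (auto elim!: simple_bochner_integrable.cases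
          intro: simple_function_compose2[where h = "\<lambda>a b. if norm a \<le> 2 * b then a else 0"])
    have "(\<integral>\<^sup>+x. norm (if norm (r i x) \<le> 2 * m i x then r i x else 0) \<partial>M) \<le> (\<integral>\<^sup>+x. ennreal 4 * h x \<partial>M)"
    proof (rule nn_integral_mono)
      fix x assume "x \<in> space M"
      then show "ennreal (norm (if norm (r i x) \<le> 2 * m i x then r i x else 0)) \<le> ennreal 4 * ennreal (h x)"
        using m(3)[of x i] h(2)[of x] by (subst ennreal_mult[symmetric]) (auto intro!: ennreal_leI)
    qed
    also have "\<dots> = ennreal 4 * (\<integral>\<^sup>+x. h x \<partial>M)"
      using h(1) by (intro nn_integral_cmult) auto
    also have "\<dots> < \<infinity>" using hfin by (simp add: ennreal_mult_less_top)
    finally show "(\<integral>\<^sup>+x. norm (if norm (r i x) \<le> 2 * m i x then r i x else 0) \<partial>M) < \<infinity>" .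
  qed
  have s_bound: "norm (s i x) \<le> 4 * h x" if "x \<in> space M" for i x
    using m(3)[OF that, of i] h(2)[of x] by (auto simp: s_def)
  \<comment> \<open>Where \<open>f x \<noteq> 0\<close>, the limit \<open>norm (f x)\<close> lies strictly below \<open>2 * h x\<close>,
    so the cut-off is eventually inactive.\<close>
  have s_lim: "AE x in M. (\<lambda>i. s i x) \<longlonglongrightarrow> f x"
    using r(2) h(3) AE_space
  proof eventually_elim
    case (elim x)
    show ?case
    proof (cases "f x = 0")
      case True
      then have "s i x = 0" for i using s_bound[OF elim(3), of i] elim(2) by simp
      then show ?thesis using True by simp
    next
      case False
      have "(\<lambda>i. norm (r i x) - 2 * m i x) \<longlonglongrightarrow> norm (f x) - 2 * h x"
        by (intro tendsto_intros elim m)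
      moreover have "norm (f x) - 2 * h x < 0" using elim(2) False by (smt (verit) zero_less_norm_iff)
      ultimately have "eventually (\<lambda>i. norm (r i x) - 2 * m i x < 0) sequentially"
        by (rule order_tendstoD)
      then have "eventually (\<lambda>i. r i x = s i x) sequentially"
        by eventually_elim (simp add: s_def)
      then show ?thesis using elim(1) by (rule Lim_transform_eventually[rotated])
    qed
  qed
  have L1: "(\<lambda>i. \<integral>\<^sup>+x. norm (f x - s i x) \<partial>M) \<longlonglongrightarrow> 0"
  proof -
    have "\<exists>k. k \<in> borel_measurable M \<and> (AE x in M. norm (f x - s i x) = k x)" for i
      using strongly_measurable_norm_version[OF f s_simple[of i]] by metis
    then obtain k where k: "\<And>i. k i \<in> borel_measurable M" "\<And>i. AE x in M. norm (f x - s i x) = k i x"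
      by metis
    have "(\<lambda>i. \<integral>\<^sup>+x. k i x \<partial>M) \<longlonglongrightarrow> (\<integral>\<^sup>+x. 0 \<partial>M)"
    proof (rule nn_integral_dominated_convergence[where w = "\<lambda>x. ennreal 5 * h x"])
      show "AE x in M. ennreal (k i x) \<le> ennreal 5 * ennreal (h x)" for i
        using k(2)[of i] h(3) AE_space
      proof eventually_elim
        case (elim x)
        have "k i x \<le> norm (f x) + norm (s i x)" using elim(1) by (metis norm_triangle_ineq4)
        also have "\<dots> \<le> 5 * h x" using elim(2) s_bound[OF elim(3), of i] by simp
        finally show ?case using h(2) by (subst ennreal_mult[symmetric]) (auto intro!: ennreal_leI)
      qed
      have "(\<integral>\<^sup>+x. ennreal 5 * h x \<partial>M) = ennreal 5 * (\<integral>\<^sup>+x. h x \<partial>M)"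
        using h(1) by (intro nn_integral_cmult) auto
      then show "(\<integral>\<^sup>+x. ennreal 5 * h x \<partial>M) < \<infinity>" using hfin by (simp add: ennreal_mult_less_top)
      have "AE x in M. \<forall>i. norm (f x - s i x) = k i x" using k(2) by (simp add: AE_all_countable)
      then show "AE x in M. (\<lambda>i. ennreal (k i x)) \<longlonglongrightarrow> 0"
        using s_lim
      proof eventually_elim
        case (elim x)
        have "(\<lambda>i. ennreal (norm (f x - s i x))) \<longlonglongrightarrow> ennreal (norm (f x - f x))"
          by (intro tendsto_ennrealI tendsto_intros elim)
        then show ?case using elim(1) by simp
      qed
    qed (use k h in auto)
    moreover have "(\<integral>\<^sup>+x. k i x \<partial>M) = (\<integral>\<^sup>+x. norm (f x - s i x) \<partial>M)" for i
      using k(2)[of i] by (intro nn_integral_cong_AE) auto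
    ultimately show ?thesis by simp
  qed
  let ?S = "\<lambda>i. Bochner_Integration.simple_bochner_integral M (s i)"
  have "Cauchy ?S"
  proof (rule CauchyI)
    fix e :: real assume e: "0 < e"
    have "eventually (\<lambda>i. (\<integral>\<^sup>+x. norm (f x - s i x) \<partial>M) < ennreal (e / 2)) sequentially"
      by (rule order_tendstoD(2)[OF L1]) (use e in simp)
    then obtain N where N: "\<And>i. i \<ge> N \<Longrightarrow> (\<integral>\<^sup>+x. norm (f x - s i x) \<partial>M) < ennreal (e / 2)"
      by (auto simp: eventually_sequentially)
    have "norm (?S i - ?S j) < e" if "i \<ge> N" "j \<ge> N" for i j
    proof -
      have "ennreal (norm (?S i - ?S j)) \<le> (\<integral>\<^sup>+x. norm (f x - s i x) \<partial>M) + (\<integral>\<^sup>+x. norm (f x - s j x) \<partial>M)"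
        by (rule simple_integral_diff_bound[OF f s_simple s_simple])
      also have "\<dots> < ennreal (e / 2) + ennreal (e / 2)" by (intro add_strict_mono N that)
      also have "\<dots> = ennreal e" using e by (simp flip: ennreal_plus)
      finally show ?thesis using e by (simp add: ennreal_less_iff)
    qed
    then show "\<exists>N. \<forall>i\<ge>N. \<forall>j\<ge>N. norm (?S i - ?S j) < e" by blast
  qed
  then obtain I where "?S \<longlonglongrightarrow> I" using Cauchy_convergent convergent_def by blast
  then show thesis
    using f s_simple L1
    by (intro that[of I]) (auto simp: has_strong_integral_def)
qed

lemma has_strong_integral_indicator:
  fixes f :: "'b \<Rightarrow> 'a::real_normed_vector"
  assumes \<Omega>: "\<Omega> \<in> sets M" and f: "has_strong_integral (restrict_space M \<Omega>) f I"
  shows "has_strong_integral M (\<lambda>x. indicator \<Omega> x *\<^sub>R f x) I"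
proof -
  have \<Omega>': "\<Omega> \<inter> space M \<in> sets M" using \<Omega> by auto
  obtain r where r: "\<And>i. Bochner_Integration.simple_bochner_integrable (restrict_space M \<Omega>) (r i)"
      "AE x in restrict_space M \<Omega>. (\<lambda>i. r i x) \<longlonglongrightarrow> f x"
    using f strongly_measurableE[of "restrict_space M \<Omega>" f] by (auto simp: has_strong_integral_def)
  obtain s where s: "\<And>i. Bochner_Integration.simple_bochner_integrable (restrict_space M \<Omega>) (s i)"
      "(\<lambda>i. \<integral>\<^sup>+x. norm (f x - s i x) \<partial>restrict_space M \<Omega>) \<longlonglongrightarrow> 0"
      "(\<lambda>i. Bochner_Integration.simple_bochner_integral (restrict_space M \<Omega>) (s i)) \<longlonglongrightarrow> I"
    using f unfolding has_strong_integral_def by blast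
  have "strongly_measurable M (\<lambda>x. indicator \<Omega> x *\<^sub>R f x)"
    unfolding strongly_measurable_def
  proof (intro exI conjI allI)
    show "Bochner_Integration.simple_bochner_integrable M (\<lambda>x. indicator \<Omega> x *\<^sub>R r i x)" for i
      using r(1) unfolding simple_bochner_integrable_restrict_space[OF \<Omega>'] .
    show "AE x in M. (\<lambda>i. indicator \<Omega> x *\<^sub>R r i x) \<longlonglongrightarrow> indicator \<Omega> x *\<^sub>R f x"
      using r(2) unfolding AE_restrict_space_iff[OF \<Omega>'] by eventually_elim (auto simp: indicator_def)
  qed
  moreover have "(\<integral>\<^sup>+x. norm (indicator \<Omega> x *\<^sub>R f x - indicator \<Omega> x *\<^sub>R s i x) \<partial>M)
      = (\<integral>\<^sup>+x. norm (f x - s i x) \<partial>restrict_space M \<Omega>)" for i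
    unfolding nn_integral_restrict_space[OF \<Omega>']
    by (intro nn_integral_cong) (auto simp: indicator_def)
  ultimately show ?thesis
    using s unfolding has_strong_integral_def simple_bochner_integrable_restrict_space[OF \<Omega>']
    by (intro conjI exI[of _ "\<lambda>i x. indicator \<Omega> x *\<^sub>R s i x"])
      (simp_all add: simple_bochner_integral_restrict_space[OF \<Omega>']
        simple_bochner_integrable_restrict_space[OF \<Omega>'])
qed

section \<open>The Riemann-Liouville kernel\<close>

lemma measurable_lebesgue_on_ident [measurable]: "(\<lambda>x. x) \<in> borel_measurable (lebesgue_on S)"
  by (intro measurable_restrict_space1 measurable_completion) simp

lemma nn_integral_lebesgue_on_Icc:
  "(\<integral>\<^sup>+x. f x \<partial>lebesgue_on {a..b::real}) = (\<integral>\<^sup>+x. f x * indicator {a..b} x \<partial>lborel)"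
proof -
  have "{a..b} \<inter> space lebesgue \<in> sets lebesgue" by simp
  from nn_integral_restrict_space[OF this] show ?thesis by (simp only: nn_integral_completion)
qed

lemma AE_lebesgue_on_neq: "AE x in lebesgue_on {a..b}. x \<noteq> (c::real)"
  by (subst AE_restrict_space_iff)
    (auto intro!: eventually_mono[OF AE_completion[OF AE_lborel_singleton[of c]]])

lemma nn_integral_powr_from_left:
  fixes a b \<beta> :: real
  assumes "a \<le> b" "0 \<le> \<beta>"
  shows "(\<integral>\<^sup>+x. (x - a) powr \<beta> * indicator {a..b} x \<partial>lborel) = ennreal ((b - a) powr (\<beta> + 1) / (\<beta> + 1))"
proof -
  have "((\<lambda>x. (x - a) powr \<beta>) has_integral
      ((b - a) powr (\<beta> + 1) / (\<beta> + 1) - (a - a) powr (\<beta> + 1) / (\<beta> + 1))) {a..b}"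
  proof (rule fundamental_theorem_of_calculus_interior)
    show "continuous_on {a..b} (\<lambda>x. (x - a) powr (\<beta> + 1) / (\<beta> + 1))"
      using assms by (intro continuous_intros continuous_on_powr') auto
    show "((\<lambda>x. (x - a) powr (\<beta> + 1) / (\<beta> + 1)) has_vector_derivative (x - a) powr \<beta>) (at x)"
      if "x \<in> {a<..<b}" for x
      unfolding has_real_derivative_iff_has_vector_derivative[symmetric]
      using that assms by (auto intro!: derivative_eq_intros simp: powr_diff)
  qed (use assms in auto)
  then show ?thesis
    using nn_integral_has_integral_lebesgue'[of "{a..b}" "\<lambda>x. (x - a) powr \<beta>"] 
    by (simp add: ennreal_mult'' ennreal_indicator)
qed

lemma nn_integral_powr_from_right:
  fixes a b \<beta> :: real
  assumes "a \<le> b" "0 \<le> \<beta>"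
  shows "(\<integral>\<^sup>+x. (b - x) powr \<beta> * indicator {a..b} x \<partial>lborel) = ennreal ((b - a) powr (\<beta> + 1) / (\<beta> + 1))"
proof -
  have "((\<lambda>x. (b - x) powr \<beta>) has_integral
      (- ((b - b) powr (\<beta> + 1) / (\<beta> + 1)) - - ((b - a) powr (\<beta> + 1) / (\<beta> + 1)))) {a..b}"
  proof (rule fundamental_theorem_of_calculus_interior)
    show "continuous_on {a..b} (\<lambda>x. - ((b - x) powr (\<beta> + 1) / (\<beta> + 1)))"
      using assms by (intro continuous_intros continuous_on_powr') auto
    show "((\<lambda>x. - ((b - x) powr (\<beta> + 1) / (\<beta> + 1))) has_vector_derivative (b - x) powr \<beta>) (at x)"
      if "x \<in> {a<..<b}" for x
      unfolding has_real_derivative_iff_has_vector_derivative[symmetric]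
      using that assms by (auto intro!: derivative_eq_intros
          simp: powr_diff minus_divide_left[symmetric] simp del: minus_divide_left)
  qed (use assms in auto)
  then show ?thesis
    using nn_integral_has_integral_lebesgue'[of "{a..b}" "\<lambda>x. (b - x) powr \<beta>"] 
    by (simp add: ennreal_mult'' ennreal_indicator)
qed

text \<open>
  The truncation \<open>s \<le> t\<close> is part of the kernel, so that the integrals for all \<open>t\<close> extend over the
  same interval and can be compared.
\<close>

definition RL_kernel :: "real \<Rightarrow> real \<Rightarrow> real \<Rightarrow> real \<Rightarrow> real" where
  "RL_kernel t0 \<alpha> t s = (if t0 \<le> s \<and> s \<le> t then (t - s) powr (\<alpha> - 1) else 0)"

lemma RL_kernel_nonneg: "0 \<le> RL_kernel t0 \<alpha> t s"
  by (simp add: RL_kernel_def)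

lemma RL_kernel_le:
  assumes "1 \<le> \<alpha>" "t \<le> t1" shows "RL_kernel t0 \<alpha> t s \<le> (t1 - t0) powr (\<alpha> - 1)"
  using assms by (auto simp: RL_kernel_def intro!: powr_mono2)

lemma measurable_RL_kernel [measurable]:
  assumes [measurable]: "f \<in> borel_measurable M" "g \<in> borel_measurable M"
  shows "(\<lambda>x. RL_kernel t0 \<alpha> (f x) (g x)) \<in> borel_measurable M"
  unfolding RL_kernel_def by measurable

text \<open>
  At \<open>s = t\<close> continuity in \<open>t\<close> fails for \<open>\<alpha> = 1\<close>, where the kernel jumps from \<open>0\<close> to \<open>1\<close>; for
  fixed \<open>t\<close> this is a null set of \<open>s\<close>.
\<close>

lemma RL_kernel_tendsto:
  assumes t: "X \<longlonglongrightarrow> t" and s: "s \<noteq> t"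
  shows "(\<lambda>n. RL_kernel t0 \<alpha> (X n) s) \<longlonglongrightarrow> RL_kernel t0 \<alpha> t s"
proof (cases "s < t")
  case True
  have "eventually (\<lambda>n. s < X n) sequentially" using order_tendstoD(1)[OF t True] .
  then have "eventually (\<lambda>n. (if t0 \<le> s then (X n - s) powr (\<alpha> - 1) else 0)
      = RL_kernel t0 \<alpha> (X n) s) sequentially"
    by eventually_elim (auto simp: RL_kernel_def)
  moreover have "(\<lambda>n. if t0 \<le> s then (X n - s) powr (\<alpha> - 1) else 0) \<longlonglongrightarrow> RL_kernel t0 \<alpha> t s"
    using True by (auto simp: RL_kernel_def intro!: tendsto_intros t)
  ultimately show ?thesis by (rule Lim_transform_eventually[rotated])
next
  case False
  then have "t < s" using s by simp
  have "eventually (\<lambda>n. X n < s) sequentially" using order_tendstoD(2)[OF t \<open>t < s\<close>] .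
  then have "eventually (\<lambda>n. 0 = RL_kernel t0 \<alpha> (X n) s) sequentially"
    by eventually_elim (auto simp: RL_kernel_def)
  moreover have "(\<lambda>n. 0) \<longlonglongrightarrow> RL_kernel t0 \<alpha> t s"
    using \<open>t < s\<close> by (auto simp: RL_kernel_def)
  ultimately show ?thesis by (rule Lim_transform_eventually[rotated])
qed

lemma RL_kernel_powr:
  "RL_kernel t0 \<alpha> t s powr q = (t - s) powr ((\<alpha> - 1) * q) * indicator {t0..t} s"
  by (cases "t0 \<le> s \<and> s \<le> t") (auto simp: RL_kernel_def powr_powr)

lemma nn_integral_RL_kernel_powr_right:
  assumes "1 \<le> \<alpha>" "0 < q" "t \<in> {t0..t1}"
  shows "(\<integral>\<^sup>+s. RL_kernel t0 \<alpha> t s powr q \<partial>lebesgue_on {t0..t1})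
    = ennreal ((t - t0) powr ((\<alpha> - 1) * q + 1) / ((\<alpha> - 1) * q + 1))"
proof -
  have "(\<integral>\<^sup>+s. RL_kernel t0 \<alpha> t s powr q \<partial>lebesgue_on {t0..t1})
      = (\<integral>\<^sup>+s. (t - s) powr ((\<alpha> - 1) * q) * indicator {t0..t} s \<partial>lborel)"
    unfolding nn_integral_lebesgue_on_Icc RL_kernel_powr
    using assms by (intro nn_integral_cong) (auto simp: indicator_def)
  also have "\<dots> = ennreal ((t - t0) powr ((\<alpha> - 1) * q + 1) / ((\<alpha> - 1) * q + 1))"
    using assms by (intro nn_integral_powr_from_right) auto
  finally show ?thesis .
qed

lemma nn_integral_RL_kernel_powr_left:
  assumes "1 \<le> \<alpha>" "0 < p" "s \<in> {t0..t1}"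
  shows "(\<integral>\<^sup>+t. RL_kernel t0 \<alpha> t s powr p \<partial>lebesgue_on {t0..t1})
    = ennreal ((t1 - s) powr ((\<alpha> - 1) * p + 1) / ((\<alpha> - 1) * p + 1))"
proof -
  have "(\<integral>\<^sup>+t. RL_kernel t0 \<alpha> t s powr p \<partial>lebesgue_on {t0..t1})
      = (\<integral>\<^sup>+t. (t - s) powr ((\<alpha> - 1) * p) * indicator {s..t1} t \<partial>lborel)"
    unfolding nn_integral_lebesgue_on_Icc RL_kernel_powr
    using assms by (intro nn_integral_cong) (auto simp: indicator_def)
  also have "\<dots> = ennreal ((t1 - s) powr ((\<alpha> - 1) * p + 1) / ((\<alpha> - 1) * p + 1))"
    using assms by (intro nn_integral_powr_from_left) auto
  finally show ?thesis .
qed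

section \<open>The Riemann-Liouville integral on Lebesgue spaces\<close>

lemma has_strong_integral_RL_integral:
  fixes f :: "real \<Rightarrow> 'a::banach"
  assumes \<alpha>: "1 \<le> \<alpha>" and t: "t \<in> {t0..t1}"
    and f: "strongly_measurable (lebesgue_on {t0..t1}) f"
    and int: "integrable (lebesgue_on {t0..t1}) (\<lambda>s. norm (f s))"
  shows "has_strong_integral (lebesgue_on {t0..t1}) (\<lambda>s. RL_kernel t0 \<alpha> t s *\<^sub>R f s)
    (Gamma \<alpha> *\<^sub>R RL_integral \<alpha> t0 f t)"
proof -
  let ?M = "lebesgue_on {t0..t1}" and ?R = "lebesgue_on {t0..t}"
  have \<Omega>: "{t0..t} \<in> sets ?M"
    using t by (auto simp: sets_restrict_space_iff)
  have R: "?R = restrict_space ?M {t0..t}"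
    using t by (simp add: restrict_restrict_space Int_absorb1)
  have "strongly_measurable ?R (\<lambda>s. (t - s) powr (\<alpha> - 1) *\<^sub>R f s)"
  proof (rule strongly_measurable_scaleR)
    show "finite_measure ?R" by (rule finite_measure_lebesgue_on) auto
    show "strongly_measurable ?R f"
      unfolding R by (rule strongly_measurable_restrict_space[OF \<Omega> f])
  qed measurable
  moreover have "(\<integral>\<^sup>+s. norm ((t - s) powr (\<alpha> - 1) *\<^sub>R f s) \<partial>?R) < \<infinity>"
  proof -
    have "(\<integral>\<^sup>+s. norm ((t - s) powr (\<alpha> - 1) *\<^sub>R f s) \<partial>?R)
      = (\<integral>\<^sup>+s. ennreal (norm ((t - s) powr (\<alpha> - 1) *\<^sub>R f s)) * indicator {t0..t} s \<partial>?M)"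
      unfolding R by (intro nn_integral_restrict_space sets.Int[OF \<Omega> sets.top])
    also have "\<dots> \<le> (\<integral>\<^sup>+s. norm ((t1 - t0) powr (\<alpha> - 1) * norm (f s)) \<partial>?M)"
      using t \<alpha> by (intro nn_integral_mono)
        (auto simp: indicator_def intro!: ennreal_leI mult_right_mono powr_mono2)
    also have "\<dots> < \<infinity>"
      using integrable_mult_right[OF int, of "(t1 - t0) powr (\<alpha> - 1)"]
      by (simp only: integrable_iff_bounded)
    finally show ?thesis .
  qed
  ultimately obtain I where I: "has_strong_integral ?R (\<lambda>s. (t - s) powr (\<alpha> - 1) *\<^sub>R f s) I"
    by (rule has_strong_integral_exists)
  have "Gamma \<alpha> > 0" using \<alpha> by (intro Gamma_real_pos) auto
  then have "Gamma \<alpha> *\<^sub>R RL_integral \<alpha> t0 f t = I"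
    unfolding RL_integral_def strong_integral_eqI[OF I] by simp
  moreover have "indicator {t0..t} s * (t - s) powr (\<alpha> - 1) = RL_kernel t0 \<alpha> t s" for s
    by (simp add: RL_kernel_def indicator_def)
  ultimately show ?thesis
    using has_strong_integral_indicator[OF \<Omega> I[unfolded R]] by simp
qed

text \<open>
  The norm of the difference at two points is at most the integral of the difference of two kernels
  against \<open>norm (f s)\<close>. For \<open>\<alpha> \<ge> 1\<close> the kernel is bounded, so dominated convergence applies.
\<close>

lemma continuous_on_RL_integral:
  fixes f :: "real \<Rightarrow> 'a::banach"
  assumes \<alpha>: "1 \<le> \<alpha>"
    and f: "strongly_measurable (lebesgue_on {t0..t1}) f"
    and int: "integrable (lebesgue_on {t0..t1}) (\<lambda>s. norm (f s))"
  shows "continuous_on {t0..t1} (RL_integral \<alpha> t0 f)"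
  unfolding continuous_on_sequentially
proof (intro allI impI ballI, elim conjE)
  fix X :: "nat \<Rightarrow> real" and t
  let ?M = "lebesgue_on {t0..t1}"
  assume t: "t \<in> {t0..t1}" and X: "\<forall>n. X n \<in> {t0..t1}" and lim: "X \<longlonglongrightarrow> t"
  let ?F = "RL_integral \<alpha> t0 f" and ?k = "RL_kernel t0 \<alpha>"
  have \<Gamma>: "Gamma \<alpha> > 0" using \<alpha> by (intro Gamma_real_pos) auto
  have [measurable]: "(\<lambda>s. norm (f s)) \<in> borel_measurable ?M" using int by auto
  have bound: "ennreal (norm (Gamma \<alpha> *\<^sub>R ?F (X n) - Gamma \<alpha> *\<^sub>R ?F t))
      \<le> (\<integral>\<^sup>+s. \<bar>?k (X n) s - ?k t s\<bar> * norm (f s) \<partial>?M)" for n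
    using has_strong_integral_norm_diff_le[OF has_strong_integral_RL_integral[OF \<alpha> _ f int, of "X n"]
        has_strong_integral_RL_integral[OF \<alpha> t f int]] X
    by (simp flip: scaleR_diff_left)
  have "(\<lambda>n. \<integral>\<^sup>+s. \<bar>?k (X n) s - ?k t s\<bar> * norm (f s) \<partial>?M) \<longlonglongrightarrow> (\<integral>\<^sup>+s. 0 \<partial>?M)"
  proof (rule nn_integral_dominated_convergence[where w = "\<lambda>s. (t1 - t0) powr (\<alpha> - 1) * norm (f s)"])
    show "AE s in ?M. ennreal (\<bar>?k (X n) s - ?k t s\<bar> * norm (f s))
        \<le> ennreal ((t1 - t0) powr (\<alpha> - 1) * norm (f s))" for n
    proof (rule AE_I2)
      fix s
      have "\<bar>?k (X n) s - ?k t s\<bar> \<le> (t1 - t0) powr (\<alpha> - 1)"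
        using RL_kernel_nonneg[of t0 \<alpha> t s] RL_kernel_nonneg[of t0 \<alpha> "X n" s]
          RL_kernel_le[OF \<alpha>, of t t1 t0 s] RL_kernel_le[OF \<alpha>, of "X n" t1 t0 s] t X by fastforce
      then show "ennreal (\<bar>?k (X n) s - ?k t s\<bar> * norm (f s))
          \<le> ennreal ((t1 - t0) powr (\<alpha> - 1) * norm (f s))"
        by (intro ennreal_leI mult_right_mono) auto
    qed
    have "(\<integral>\<^sup>+s. norm ((t1 - t0) powr (\<alpha> - 1) * norm (f s)) \<partial>?M) < \<infinity>"
      using integrable_mult_right[OF int, of "(t1 - t0) powr (\<alpha> - 1)"]
      by (simp only: integrable_iff_bounded)
    then show "(\<integral>\<^sup>+s. (t1 - t0) powr (\<alpha> - 1) * norm (f s) \<partial>?M) < \<infinity>"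
      by (simp add: abs_mult)
    show "AE s in ?M. (\<lambda>n. ennreal (\<bar>?k (X n) s - ?k t s\<bar> * norm (f s))) \<longlonglongrightarrow> 0"
      using AE_lebesgue_on_neq[where a = t0 and b = t1 and c = t]
    proof eventually_elim
      case (elim s)
      have "(\<lambda>n. ennreal (\<bar>?k (X n) s - ?k t s\<bar> * norm (f s))) \<longlonglongrightarrow> ennreal (\<bar>?k t s - ?k t s\<bar> * norm (f s))"
        by (intro tendsto_ennrealI tendsto_intros RL_kernel_tendsto lim elim)
      then show ?case by simp
    qed
  qed measurable
  then have upper: "(\<lambda>n. \<integral>\<^sup>+s. \<bar>?k (X n) s - ?k t s\<bar> * norm (f s) \<partial>?M) \<longlonglongrightarrow> 0"
    by simp
  have "(\<lambda>n. ennreal (norm (Gamma \<alpha> *\<^sub>R ?F (X n) - Gamma \<alpha> *\<^sub>R ?F t))) \<longlonglongrightarrow> ennreal 0"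
    unfolding ennreal_0
    by (rule tendsto_sandwich[OF always_eventually always_eventually tendsto_const upper])
      (use bound in simp_all)
  then have "(\<lambda>n. norm (Gamma \<alpha> *\<^sub>R ?F (X n) - Gamma \<alpha> *\<^sub>R ?F t)) \<longlonglongrightarrow> 0"
    by (rule tendsto_ennrealD) auto
  then have "(\<lambda>n. Gamma \<alpha> *\<^sub>R ?F (X n)) \<longlonglongrightarrow> Gamma \<alpha> *\<^sub>R ?F t"
    by (simp only: tendsto_norm_zero_iff LIM_zero_iff)
  from tendsto_scaleR[OF tendsto_const this, of "1 / Gamma \<alpha>"]
  show "(?F \<circ> X) \<longlonglongrightarrow> ?F t"
    using \<Gamma> by (simp only: comp_def scaleR_scaleR) simp
qed

text \<open>
  The step functions \<open>F \<circ> d n\<close>, where \<open>d n t\<close> is the largest point of the form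
  \<open>a + j / (n + 1)\<close> with integer \<open>j\<close> that does not exceed \<open>t\<close>, converge to \<open>F\<close>; rounding down keeps
  \<open>d n t\<close> in the interval.
\<close>

lemma continuous_on_imp_strongly_measurable:
  fixes F :: "real \<Rightarrow> 'a::real_normed_vector"
  assumes F: "continuous_on {a..b} F"
  shows "strongly_measurable (lebesgue_on {a..b}) F"
proof -
  interpret finite_measure "lebesgue_on {a..b}" by (rule finite_measure_lebesgue_on) auto
  define d where "d n t = a + real_of_int \<lfloor>(t - a) * real (Suc n)\<rfloor> / real (Suc n)" for n t
  have d: "d n t \<le> t" "t - 1 / real (Suc n) \<le> d n t" for n t
  proof -
    have "real_of_int \<lfloor>(t - a) * real (Suc n)\<rfloor> / real (Suc n) \<le> (t - a) * real (Suc n) / real (Suc n)"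
      by (intro divide_right_mono) auto
    then show "d n t \<le> t" by (simp add: d_def)
    have "((t - a) * real (Suc n) - 1) / real (Suc n) \<le> real_of_int \<lfloor>(t - a) * real (Suc n)\<rfloor> / real (Suc n)"
      by (intro divide_right_mono) linarith+
    then show "t - 1 / real (Suc n) \<le> d n t" by (simp add: d_def diff_divide_distrib)
  qed
  have d_in: "d n t \<in> {a..b}" if "t \<in> {a..b}" for n t
    using that d(1)[of n t] by (auto simp: d_def)
  have "Bochner_Integration.simple_bochner_integrable (lebesgue_on {a..b}) (\<lambda>t. F (d n t))" for n
  proof (rule simple_bochner_integrable.intros)
    have "simple_function (lebesgue_on {a..b}) (\<lambda>t. \<lfloor>(t - a) * real (Suc n)\<rfloor>)"
      unfolding simple_function_def
    proof
      have "(\<lambda>t. \<lfloor>(t - a) * real (Suc n)\<rfloor>) ` {a..b} \<subseteq> {0..\<lfloor>(b - a) * real (Suc n)\<rfloor>}"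
        by (auto intro!: floor_mono mult_right_mono)
      then show "finite ((\<lambda>t. \<lfloor>(t - a) * real (Suc n)\<rfloor>) ` space (lebesgue_on {a..b}))"
        by (simp add: finite_subset)
      have m: "(\<lambda>t. \<lfloor>(t - a) * real (Suc n)\<rfloor>) \<in> measurable (lebesgue_on {a..b}) (count_space UNIV)"
        by measurable
      then show "\<forall>x\<in>(\<lambda>t. \<lfloor>(t - a) * real (Suc n)\<rfloor>) ` space (lebesgue_on {a..b}).
          (\<lambda>t. \<lfloor>(t - a) * real (Suc n)\<rfloor>) -` {x} \<inter> space (lebesgue_on {a..b}) \<in> sets (lebesgue_on {a..b})"
        by (intro ballI measurable_sets[OF m]) simp
    qed
    then have "simple_function (lebesgue_on {a..b})
        ((\<lambda>j. F (a + real_of_int j / real (Suc n))) \<circ> (\<lambda>t. \<lfloor>(t - a) * real (Suc n)\<rfloor>))"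
      by (rule simple_function_compose)
    then show "simple_function (lebesgue_on {a..b}) (\<lambda>t. F (d n t))"
      by (simp add: d_def comp_def)
  qed simp
  moreover have "(\<lambda>n. F (d n t)) \<longlonglongrightarrow> F t" if t: "t \<in> {a..b}" for t
  proof -
    have "(\<lambda>n. t - 1 / real (Suc n)) \<longlonglongrightarrow> t - 0"
      by (intro tendsto_intros LIMSEQ_inverse_real_of_nat[unfolded inverse_eq_divide])
    then have "(\<lambda>n. d n t) \<longlonglongrightarrow> t"
      by (intro real_tendsto_sandwich[of _ "\<lambda>n. d n t" _ "\<lambda>n. t"]) (use d in auto)
    then show ?thesis
      using F t d_in by (auto simp: continuous_on_sequentially comp_def)
  qed
  ultimately show ?thesis
    unfolding strongly_measurable_def by (intro exI[of _ "\<lambda>n t. F (d n t)"]) (auto intro!: AE_I2)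
qed

lemma Lp_space_norm_integrable:
  assumes p: "1 \<le> p" and f: "f \<in> Lp_space p t0 t1"
  shows "integrable (lebesgue_on {t0..t1}) (\<lambda>s. norm (f s))"
proof (rule Bochner_Integration.integrable_bound)
  let ?M = "lebesgue_on {t0..t1}"
  have int: "integrable ?M (\<lambda>s. norm (f s) powr p)"
    using f by (simp add: Lp_space_def)
  show "integrable ?M (\<lambda>s. 1 + norm (f s) powr p)"
    using int by auto
  have "(\<lambda>s. (norm (f s) powr p) powr (1 / p)) \<in> borel_measurable ?M"
    using borel_measurable_integrable[OF int] by measurable
  then show "(\<lambda>s. norm (f s)) \<in> borel_measurable ?M"
    using p by (simp add: powr_powr)
  have "x \<le> 1 + x powr p" if "0 \<le> x" for x :: real
  proof (cases "x \<le> 1")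
    case False
    then show ?thesis using powr_mono[of 1 p x] p by simp
  qed (simp add: add_increasing2)
  then show "AE s in ?M. norm (norm (f s)) \<le> norm (1 + norm (f s) powr p)"
    by (intro AE_I2) (smt (verit) norm_ge_zero powr_ge_zero real_norm_def)
qed

text \<open>
  The scalar bound for a factored kernel, carried over to functions with values in \<open>'a\<close>. The
  continuity of the Riemann-Liouville integral is what places it in the space.
\<close>

lemma Lp_opnorm_RL_integral_le_factored:
  fixes a b :: "real \<Rightarrow> real \<Rightarrow> real" and A :: "real \<Rightarrow> real"
  assumes \<alpha>: "1 \<le> \<alpha>" and pq: "1 < p" "1 < q" "1 / p + 1 / q = 1" and D: "0 \<le> D"
    and meas: "case_prod a \<in> borel_measurable (lebesgue_on {t0..t1} \<Otimes>\<^sub>M lebesgue_on {t0..t1})"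
      "case_prod b \<in> borel_measurable (lebesgue_on {t0..t1} \<Otimes>\<^sub>M lebesgue_on {t0..t1})"
      "A \<in> borel_measurable (lebesgue_on {t0..t1})"
    and nonneg: "\<And>t s. 0 \<le> a t s" "\<And>t s. 0 \<le> b t s"
    and kernel: "\<And>t s. t \<in> {t0..t1} \<Longrightarrow> s \<in> {t0..t1} \<Longrightarrow> RL_kernel t0 \<alpha> t s = a t s * b t s"
    and A: "AE t in lebesgue_on {t0..t1}. 0 < A t \<and>
      (\<integral>\<^sup>+s. a t s powr q \<partial>lebesgue_on {t0..t1}) \<le> ennreal (A t)"
    and B: "AE s in lebesgue_on {t0..t1}.
      (\<integral>\<^sup>+t. A t powr (p / q) * b t s powr p \<partial>lebesgue_on {t0..t1}) \<le> ennreal D"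
  shows "Lp_opnorm p t0 t1 (RL_integral \<alpha> t0 :: (real \<Rightarrow> 'a::banach) \<Rightarrow> real \<Rightarrow> 'a)
    \<le> ennreal (D powr (1 / p) / Gamma \<alpha>)"
  unfolding Lp_opnorm_def
proof (rule Inf_lower, intro CollectI exI conjI ballI)
  let ?M = "lebesgue_on {t0..t1}" and ?C = "D powr (1 / p) / Gamma \<alpha>"
  have \<Gamma>: "Gamma \<alpha> > 0" using \<alpha> by (intro Gamma_real_pos) auto
  then show "0 \<le> ?C" by simp
  fix f :: "real \<Rightarrow> 'a" assume f: "f \<in> Lp_space p t0 t1"
  let ?F = "RL_integral \<alpha> t0 f"
  have fm: "strongly_measurable ?M f" and fp: "integrable ?M (\<lambda>s. norm (f s) powr p)"
    using f by (auto simp: Lp_space_def)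
  have f1: "integrable ?M (\<lambda>s. norm (f s))"
    using pq f by (intro Lp_space_norm_integrable) auto
  have cont: "continuous_on {t0..t1} ?F"
    by (rule continuous_on_RL_integral[OF \<alpha> fm f1])
  have Fp: "integrable ?M (\<lambda>t. norm (?F t) powr p)"
    using pq by (intro continuous_imp_integrable_real continuous_on_powr' continuous_intros cont) auto
  show "?F \<in> Lp_space p t0 t1"
    using continuous_on_imp_strongly_measurable[OF cont] Fp by (simp add: Lp_space_def)
  have "(\<integral>\<^sup>+t. (Gamma \<alpha> * norm (?F t)) powr p \<partial>?M) \<le> ennreal D * (\<integral>\<^sup>+s. norm (f s) powr p \<partial>?M)"
  proof (rule factored_kernel_Lp_bound[OF _ pq meas _ nonneg _ _ _ A B])
    show "sigma_finite_measure ?M"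
      by (intro finite_measure.axioms(1) finite_measure_lebesgue_on) auto
    show "AE t in ?M. ennreal (Gamma \<alpha> * norm (?F t)) \<le> (\<integral>\<^sup>+s. a t s * (b t s * norm (f s)) \<partial>?M)"
    proof (rule AE_I2)
      fix t assume "t \<in> space ?M"
      then have t: "t \<in> {t0..t1}" by simp
      have "ennreal (Gamma \<alpha> * norm (?F t)) \<le> (\<integral>\<^sup>+s. norm (RL_kernel t0 \<alpha> t s *\<^sub>R f s) \<partial>?M)"
        using has_strong_integral_norm_diff_le[OF
          has_strong_integral_RL_integral[OF \<alpha> t fm f1] has_strong_integral_zero] \<Gamma>
        by simp
      also have "\<dots> = (\<integral>\<^sup>+s. a t s * (b t s * norm (f s)) \<partial>?M)"
        using kernel[OF t] nonneg by (intro nn_integral_cong) (simp add: mult.assoc)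
      finally show "ennreal (Gamma \<alpha> * norm (?F t)) \<le> (\<integral>\<^sup>+s. a t s * (b t s * norm (f s)) \<partial>?M)" .
    qed
  qed (use f1 \<Gamma> in auto)
  also have "(\<integral>\<^sup>+s. norm (f s) powr p \<partial>?M) = ennreal (LINT s|?M. norm (f s) powr p)"
    using fp by (intro nn_integral_eq_integral) auto
  also have "(\<integral>\<^sup>+t. (Gamma \<alpha> * norm (?F t)) powr p \<partial>?M) = (\<integral>\<^sup>+t. Gamma \<alpha> powr p * norm (?F t) powr p \<partial>?M)"
    using \<Gamma> by (simp add: powr_mult)
  also have "\<dots> = ennreal (LINT t|?M. Gamma \<alpha> powr p * norm (?F t) powr p)"
    using Fp by (intro nn_integral_eq_integral) auto
  finally have "Gamma \<alpha> powr p * (LINT t|?M. norm (?F t) powr p) \<le> D * (LINT s|?M. norm (f s) powr p)"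
    using D by (simp flip: ennreal_mult)
  then have "(Gamma \<alpha> powr p * (LINT t|?M. norm (?F t) powr p)) powr (1 / p)
      \<le> (D * (LINT s|?M. norm (f s) powr p)) powr (1 / p)"
    using pq by (intro powr_mono2) auto
  then have "Gamma \<alpha> * Lp_norm p t0 t1 ?F \<le> D powr (1 / p) * Lp_norm p t0 t1 f"
    using pq \<Gamma> D by (simp add: Lp_norm_def powr_mult powr_powr)
  then show "Lp_norm p t0 t1 ?F \<le> ?C * Lp_norm p t0 t1 f"
    using \<Gamma> by (simp add: field_simps)
qed simp

section \<open>The two estimates and their comparison with the classical constant\<close>

text \<open>
  Plain Hoelder: the whole kernel is paired with \<open>norm (f s)\<close>, and the integral over a row of its
  \<open>q\<close>-th power is the power \<open>A\<close> of \<open>t - t0\<close>.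
\<close>

lemma Lp_opnorm_RL_integral_le_row_norms:
  assumes t: "t0 < t1" and \<alpha>: "1 \<le> \<alpha>" and pq: "1 < p" "1 < q" "1 / p + 1 / q = 1"
  shows "Lp_opnorm p t0 t1 (RL_integral \<alpha> t0 :: (real \<Rightarrow> 'a::banach) \<Rightarrow> real \<Rightarrow> 'a)
    \<le> ennreal ((t1 - t0) powr \<alpha> /
        (Gamma \<alpha> * ((\<alpha> - 1) * q + 1) powr (1 / q) * (\<alpha> * p) powr (1 / p)))"
proof -
  let ?M = "lebesgue_on {t0..t1}"
  define c where "c = (\<alpha> - 1) * q + 1"
  define A where "A t = (t - t0) powr c / c" for t
  define D where "D = (t1 - t0) powr (\<alpha> * p) / (\<alpha> * p) / c powr (p / q)"
  have c: "c > 0" using \<alpha> pq by (simp add: c_def add_nonneg_pos)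
  have \<alpha>p: "\<alpha> * p > 1" using \<alpha> pq by (metis less_1_mult mult_1 order_le_less)
  have exponent: "c * (p / q) = \<alpha> * p - 1"
    using pq by (simp add: c_def field_simps)
  have "Lp_opnorm p t0 t1 (RL_integral \<alpha> t0 :: (real \<Rightarrow> 'a) \<Rightarrow> real \<Rightarrow> 'a)
      \<le> ennreal (D powr (1 / p) / Gamma \<alpha>)"
  proof (rule Lp_opnorm_RL_integral_le_factored[OF \<alpha> pq])
    show "case_prod (RL_kernel t0 \<alpha>) \<in> borel_measurable (?M \<Otimes>\<^sub>M ?M)"
      by (simp add: case_prod_beta') measurable
    show "A \<in> borel_measurable ?M" unfolding A_def by measurable
    show "AE t in ?M. 0 < A t \<and> (\<integral>\<^sup>+s. RL_kernel t0 \<alpha> t s powr q \<partial>?M) \<le> ennreal (A t)"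
      using AE_lebesgue_on_neq[where a = t0 and b = t1 and c = t0] AE_space
    proof eventually_elim
      case (elim t)
      then show ?case
        using nn_integral_RL_kernel_powr_right[OF \<alpha>, of q t t0 t1] pq c by (simp add: A_def c_def)
    qed
    show "AE s in ?M. (\<integral>\<^sup>+t. A t powr (p / q) * 1 powr p \<partial>?M) \<le> ennreal D"
    proof (rule AE_I2)
      have "(\<integral>\<^sup>+t. A t powr (p / q) * 1 powr p \<partial>?M)
          = (\<integral>\<^sup>+t. ennreal (1 / c powr (p / q))
              * ennreal ((t - t0) powr (\<alpha> * p - 1) * indicator {t0..t1} t) \<partial>lborel)"
        unfolding nn_integral_lebesgue_on_Icc using c exponent
        by (intro nn_integral_cong)
          (auto simp: A_def powr_divide powr_powr indicator_def simp flip: ennreal_mult)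
      also have "\<dots> = ennreal (1 / c powr (p / q)) * ennreal ((t1 - t0) powr (\<alpha> * p) / (\<alpha> * p))"
        using nn_integral_powr_from_left[of t0 t1 "\<alpha> * p - 1"] t \<alpha>p by (subst nn_integral_cmult) auto
      also have "\<dots> = ennreal D"
        using \<alpha>p by (simp add: D_def flip: ennreal_mult)
      finally show "(\<integral>\<^sup>+t. A t powr (p / q) * 1 powr p \<partial>?M) \<le> ennreal D" by simp
    qed
  qed (use \<alpha>p c in \<open>auto simp: D_def RL_kernel_nonneg\<close>)
  also have "D powr (1 / p) / Gamma \<alpha>
      = (t1 - t0) powr \<alpha> / (Gamma \<alpha> * c powr (1 / q) * (\<alpha> * p) powr (1 / p))"
    using pq \<alpha> \<alpha>p c t by (simp add: D_def powr_divide powr_powr powr_mult mult_ac)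
  finally show ?thesis by (simp add: c_def)
qed

text \<open>
  The weight \<open>w s\<close> is, up to a constant factor, the \<open>L\<^sup>p\<close> norm of the column of the kernel through
  \<open>s\<close>. Therefore all columns of \<open>k / w\<close> with \<open>s < t1\<close> have the same norm, and the \<open>L\<^sup>q\<close> norm of
  \<open>w\<close> accounts for the rest of the constant.
\<close>

lemma Lp_opnorm_RL_integral_le_column_norms:
  assumes t: "t0 < t1" and \<alpha>: "1 \<le> \<alpha>" and pq: "1 < p" "1 < q" "1 / p + 1 / q = 1"
  shows "Lp_opnorm p t0 t1 (RL_integral \<alpha> t0 :: (real \<Rightarrow> 'a::banach) \<Rightarrow> real \<Rightarrow> 'a)
    \<le> ennreal ((t1 - t0) powr \<alpha> /
        (Gamma \<alpha> * ((\<alpha> - 1) * p + 1) powr (1 / p) * (\<alpha> * q) powr (1 / q)))"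
proof -
  let ?M = "lebesgue_on {t0..t1}"
  define c where "c = (\<alpha> - 1) * p + 1"
  define w where "w s = (t1 - s) powr (c / p)" for s
  define W where "W = (t1 - t0) powr (\<alpha> * q) / (\<alpha> * q)"
  define D where "D = W powr (p / q) / c"
  have c: "c > 0" using \<alpha> pq by (simp add: c_def add_nonneg_pos)
  have \<alpha>q: "\<alpha> * q > 1" using \<alpha> pq by (metis less_1_mult mult_1 order_le_less)
  have W: "W > 0" using t \<alpha>q by (simp add: W_def)
  have exponent: "c / p * q = \<alpha> * q - 1"
    using pq by (simp add: c_def field_simps)
  have "Lp_opnorm p t0 t1 (RL_integral \<alpha> t0 :: (real \<Rightarrow> 'a) \<Rightarrow> real \<Rightarrow> 'a)
      \<le> ennreal (D powr (1 / p) / Gamma \<alpha>)"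
  proof (rule Lp_opnorm_RL_integral_le_factored[OF \<alpha> pq,
        where A = "\<lambda>t. W" and a = "\<lambda>t. w" and b = "\<lambda>t s. RL_kernel t0 \<alpha> t s / w s"])
    show "(\<lambda>(t, s). RL_kernel t0 \<alpha> t s / w s) \<in> borel_measurable (?M \<Otimes>\<^sub>M ?M)"
      unfolding w_def by (simp add: case_prod_beta') measurable
    show "(\<lambda>(t, s). w s) \<in> borel_measurable (?M \<Otimes>\<^sub>M ?M)"
      unfolding w_def by (simp add: case_prod_beta') measurable
    show "RL_kernel t0 \<alpha> t s = w s * (RL_kernel t0 \<alpha> t s / w s)" if "t \<in> {t0..t1}" "s \<in> {t0..t1}" for t s
      using that by (auto simp: w_def RL_kernel_def)
    show "AE t in ?M. 0 < W \<and> (\<integral>\<^sup>+s. w s powr q \<partial>?M) \<le> ennreal W"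
    proof (rule AE_I2)
      have "(\<integral>\<^sup>+s. w s powr q \<partial>?M) = (\<integral>\<^sup>+s. (t1 - s) powr (\<alpha> * q - 1) * indicator {t0..t1} s \<partial>lborel)"
        unfolding nn_integral_lebesgue_on_Icc using exponent
        by (intro nn_integral_cong) (auto simp: w_def powr_powr indicator_def)
      also have "\<dots> = ennreal W"
        using nn_integral_powr_from_right[of t0 t1 "\<alpha> * q - 1"] t \<alpha>q by (simp add: W_def)
      finally show "0 < W \<and> (\<integral>\<^sup>+s. w s powr q \<partial>?M) \<le> ennreal W" using W by simp
    qed
    show "AE s in ?M. (\<integral>\<^sup>+t. W powr (p / q) * (RL_kernel t0 \<alpha> t s / w s) powr p \<partial>?M) \<le> ennreal D"
      using AE_lebesgue_on_neq[where a = t0 and b = t1 and c = t1] AE_space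
    proof eventually_elim
      case (elim s)
      then have s: "s \<in> {t0..t1}" "s < t1" by auto
      have "(\<integral>\<^sup>+t. W powr (p / q) * (RL_kernel t0 \<alpha> t s / w s) powr p \<partial>?M)
          = (\<integral>\<^sup>+t. ennreal (W powr (p / q) / (t1 - s) powr c) * ennreal (RL_kernel t0 \<alpha> t s powr p) \<partial>?M)"
        using pq s by (intro nn_integral_cong)
          (simp add: w_def powr_divide powr_powr RL_kernel_nonneg flip: ennreal_mult)
      also have "\<dots> = ennreal (W powr (p / q) / (t1 - s) powr c) * ennreal ((t1 - s) powr c / c)"
        using nn_integral_RL_kernel_powr_left[OF \<alpha> _ s(1), of p] pq
        by (subst nn_integral_cmult) (auto simp: c_def)
      also have "\<dots> = ennreal D"
        using s c by (simp add: D_def flip: ennreal_mult)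
      finally show ?case by simp
    qed
  qed (use c in \<open>auto simp: D_def w_def RL_kernel_nonneg\<close>)
  also have "D powr (1 / p) / Gamma \<alpha>
      = (t1 - t0) powr \<alpha> / (Gamma \<alpha> * c powr (1 / p) * (\<alpha> * q) powr (1 / q))"
    using pq \<alpha> \<alpha>q c t W by (simp add: D_def W_def powr_divide powr_powr powr_mult mult_ac)
  finally show ?thesis by (simp add: c_def)
qed

text \<open>
  With \<open>\<alpha> = \<alpha> powr (1 / p) * \<alpha> powr (1 / q)\<close> the factors are compared one by one:
  \<open>(\<alpha> - 1) * p + 1 - \<alpha> = (\<alpha> - 1) * (p - 1) \<ge> 0\<close>, and \<open>\<alpha> < \<alpha> * q\<close> gives the strictness.
\<close>

lemma powr_constant_less_Gamma_Suc:
  fixes \<alpha> p q T :: real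
  assumes T: "0 < T" and \<alpha>: "1 \<le> \<alpha>" and pq: "1 < p" "1 < q" "1 / p + 1 / q = 1"
  shows "T powr \<alpha> / (Gamma \<alpha> * ((\<alpha> - 1) * p + 1) powr (1 / p) * (\<alpha> * q) powr (1 / q))
    < T powr \<alpha> / Gamma (\<alpha> + 1)"
proof -
  have \<Gamma>: "Gamma \<alpha> > 0" using \<alpha> by (intro Gamma_real_pos) auto
  have "0 \<le> (\<alpha> - 1) * (p - 1)" using \<alpha> pq by simp
  then have "\<alpha> \<le> (\<alpha> - 1) * p + 1" by (simp add: algebra_simps)
  then have le: "\<alpha> powr (1 / p) \<le> ((\<alpha> - 1) * p + 1) powr (1 / p)"
    using \<alpha> pq by (intro powr_mono2) auto
  have less: "\<alpha> powr (1 / q) < (\<alpha> * q) powr (1 / q)"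
    using \<alpha> pq by (intro powr_less_mono2) auto
  have "\<alpha> = \<alpha> powr (1 / p) * \<alpha> powr (1 / q)"
    using \<alpha> pq by (simp flip: powr_add)
  also have "\<dots> < ((\<alpha> - 1) * p + 1) powr (1 / p) * (\<alpha> * q) powr (1 / q)"
    using le less \<alpha> by (intro mult_le_less_imp_less) auto
  finally have "Gamma (\<alpha> + 1) < Gamma \<alpha> * (((\<alpha> - 1) * p + 1) powr (1 / p) * (\<alpha> * q) powr (1 / q))"
    using \<Gamma> \<alpha> by (subst Gamma_plus1) (auto simp: nonpos_Ints_def mult.commute[of \<alpha>])
  moreover have "Gamma (\<alpha> + 1) > 0" using \<alpha> by (intro Gamma_real_pos) auto
  ultimately show ?thesis
    using T by (intro frac_less2) (auto simp: mult.assoc)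
qed

theorem theorem42:
  fixes t0 t1 \<alpha> p p' :: real
    and N :: ennreal
  assumes "t0 < t1" and "1 \<le> \<alpha>" and "1 < p" and "p' = p / (p - 1)"
    and "N = Lp_opnorm p t0 t1 (RL_integral \<alpha> t0 :: (real \<Rightarrow> 'a::banach) \<Rightarrow> real \<Rightarrow> 'a)"
  shows "(p \<le> 2 \<longrightarrow>
           N \<le> ennreal ((t1 - t0) powr \<alpha> /
                 (Gamma \<alpha> * ((\<alpha> - 1) * p + 1) powr (1 / p) * (\<alpha> * p') powr (1 / p'))) \<and>
           (t1 - t0) powr \<alpha> /
             (Gamma \<alpha> * ((\<alpha> - 1) * p + 1) powr (1 / p) * (\<alpha> * p') powr (1 / p'))
             < (t1 - t0) powr \<alpha> / Gamma (\<alpha> + 1)) \<and>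
         (2 < p \<longrightarrow>
           N \<le> ennreal ((t1 - t0) powr \<alpha> /
                 (Gamma \<alpha> * ((\<alpha> - 1) * p' + 1) powr (1 / p') * (\<alpha> * p) powr (1 / p))) \<and>
           (t1 - t0) powr \<alpha> /
             (Gamma \<alpha> * ((\<alpha> - 1) * p' + 1) powr (1 / p') * (\<alpha> * p) powr (1 / p))
             < (t1 - t0) powr \<alpha> / Gamma (\<alpha> + 1))"
proof -
  have pq: "1 < p'" "1 / p + 1 / p' = 1" "1 / p' + 1 / p = 1"
    using assms(3) unfolding assms(4) by (auto simp: field_simps)
  show ?thesis
    unfolding assms(5) using assms(1-3) pq
    by (intro conjI impI Lp_opnorm_RL_integral_le_column_norms Lp_opnorm_RL_integral_le_row_norms
        powr_constant_less_Gamma_Suc) auto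
qed

end
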